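(* Let $k\ge 3$ be an integer. For all integers $m$ with $k<m$, $$W_c\!\left(k,\,3+\left\lceil\frac{(m-k)\cdot k}{k-1}\right\rceil\right)>mk.$$
   Context: For positive integers $k,N,d$ with $k\ge 3$, a $k$-term cyclic arithmetic progression mod $N$ with common difference $d$ is a $k$-element subset of $\mathbb{Z}_N=\mathbb{Z}/N\mathbb{Z}$ of the form $\{t,t+d,\ldots,t+(k-1)d\}$ for some $t\in\mathbb{Z}_N$ (so these $k$ elements are pairwise distinct mod $N$). An $r$-coloring of a set $S$ is a map $c:S\to\{1,\ldots,r\}$; a subset of $S$ is monochromatic if $c$ is constant on it. For integers $k\ge 3$, $r\ge 2$, the cyclic Van der Waerden number $W_c(k,r)$ is the smallest modulus $N$ such that for all positive integers $M\ge N$ and every $r$-coloring of $\mathbb{Z}_M$, there exists a monochromatic $k$-term cyclic arithmetic progression mod $M$ in $\mathbb{Z}_M$. (This number always exists.) *)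

theory Defs
  imports Complex_Main "HOL-Library.FuncSet"
begin

text \<open>The residues mod \<open>N\<close> are represented by \<open>{0..<N}\<close>. The condition \<open>card A = k\<close>
  says that the \<open>k\<close> listed terms are pairwise distinct mod \<open>N\<close>.\<close>

definition cyclic_AP :: "nat \<Rightarrow> nat \<Rightarrow> nat \<Rightarrow> nat set \<Rightarrow> bool" where
  "cyclic_AP k N d A \<longleftrightarrow>
     card A = k \<and> (\<exists>t\<in>{0..<N}. A = (\<lambda>i. (t + i * d) mod N) ` {0..<k})"

definition coloring :: "nat \<Rightarrow> 'a set \<Rightarrow> ('a \<Rightarrow> nat) \<Rightarrow> bool" where
  "coloring r S c \<longleftrightarrow> c \<in> S \<rightarrow> {1..r}"

definition monochromatic :: "('a \<Rightarrow> nat) \<Rightarrow> 'a set \<Rightarrow> bool" where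
  "monochromatic c A \<longleftrightarrow> (\<exists>j. \<forall>x\<in>A. c x = j)"

definition W_c :: "nat \<Rightarrow> nat \<Rightarrow> nat" where
  "W_c k r = (LEAST N. N > 0 \<and>
     (\<forall>M\<ge>N. \<forall>c. coloring r {0..<M} c \<longrightarrow>
        (\<exists>d>0. \<exists>A. cyclic_AP k M d A \<and> monochromatic c A)))"

end

theory Submission imports Defs begin

text \<open>Van der Waerden's theorem makes \<open>W_c k r\<close> a genuine minimum, so a lower bound \<open>W_c k r > m * k\<close>
  only needs a coloring of the residues mod \<open>m * k\<close> without monochromatic progressions.
  Three colors handle the first \<open>k ^ 2\<close> residues: there are at most \<open>k ^ 4 / 2\<close> progressions among
  them, so for \<open>k \<ge> 8\<close> a random 3-coloring works, and for \<open>k \<le> 7\<close> there is an explicit coloring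
  that works for all \<open>m > k\<close> at once. The remaining \<open>(m - k) * k\<close> residues are cut into blocks of
  \<open>k - 1\<close>, each with its own color, too small to contain a progression.\<close>

section \<open>Van der Waerden's theorem\<close>

text \<open>The bound is put on \<open>a + k * d\<close>, one step past the \<open>k\<close> terms,
  because color focusing needs that extra point inside the window as the next focus.\<close>

definition vdw :: "nat \<Rightarrow> bool" where
  "vdw k \<longleftrightarrow> (\<forall>r. \<exists>N. \<forall>c::nat \<Rightarrow> nat. (\<forall>x. c x < r) \<longrightarrow>
     (\<exists>a d. 0 < d \<and> a + k * d < N \<and> (\<forall>i<k. c (a + i * d) = c a)))"

text \<open>Allows whole blocks to be used as colors: there the color set consists of lists of a
  fixed length.\<close>

lemma vdw_finite_colors:
  assumes "vdw k" and "finite C"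
  shows "\<exists>N. \<forall>c::nat \<Rightarrow> 'b. (\<forall>x. c x \<in> C) \<longrightarrow>
     (\<exists>a d. 0 < d \<and> a + k * d < N \<and> (\<forall>i<k. c (a + i * d) = c a))"
proof -
  obtain h where h: "bij_betw h C {..<card C}"
    using bij_betw_iff_card[of C "{..<card C}"] \<open>finite C\<close> by auto
  obtain N where N: "\<And>c::nat \<Rightarrow> nat. (\<forall>x. c x < card C) \<Longrightarrow>
      \<exists>a d. 0 < d \<and> a + k * d < N \<and> (\<forall>i<k. c (a + i * d) = c a)"
    using assms(1) unfolding vdw_def by metis
  show ?thesis
  proof (rule exI[of _ N], intro allI impI)
    fix c :: "nat \<Rightarrow> 'b" assume c: "\<forall>x. c x \<in> C"
    then have "\<forall>x. (h \<circ> c) x < card C" using bij_betwE[OF h] by auto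
    from N[OF this] obtain a d where "0 < d" "a + k * d < N"
      and *: "\<forall>i<k. (h \<circ> c) (a + i * d) = (h \<circ> c) a" by blast
    moreover have "\<forall>i<k. c (a + i * d) = c a"
      using * c bij_betw_imp_inj_on[OF h] by (auto dest: inj_onD)
    ultimately show "\<exists>a d. 0 < d \<and> a + k * d < N \<and> (\<forall>i<k. c (a + i * d) = c a)" by blast
  qed
qed

text \<open>Color-focused progressions, recorded only by their colors. As \<open>Q\<close> is a set,
  the usual demand for distinct colors becomes a condition on \<open>card Q\<close>.\<close>

definition focused :: "nat \<Rightarrow> (nat \<Rightarrow> nat) \<Rightarrow> nat \<Rightarrow> nat set \<Rightarrow> bool" where
  "focused k c f Q \<longleftrightarrow>
     (\<forall>q\<in>Q. \<exists>a d. 0 < d \<and> a + k * d = f \<and> (\<forall>i<k. c (a + i * d) = q))"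

text \<open>A progression of difference \<open>d\<close> inside the block, moved one block further
  (by \<open>e\<close>) at each step, becomes one of difference \<open>d + e\<close>. The copies of
  the old focus form a new progression of difference \<open>e\<close>. After \<open>k\<close> steps
  all of them arrive at \<open>s + f + k * e\<close>.\<close>

lemma focused_shift:
  assumes "focused k (\<lambda>x. c (s + x)) f Q" and "e > 0"
    and per: "\<And>i x. i < k \<Longrightarrow> x < N \<Longrightarrow> c (s + x + i * e) = c (s + x)"
    and "f < N"
  shows "focused k c (s + f + k * e) (insert (c (s + f)) Q)"
  unfolding focused_def
proof
  fix q assume "q \<in> insert (c (s + f)) Q"
  then consider "q = c (s + f)" | "q \<in> Q" by blast
  then show "\<exists>a d. 0 < d \<and> a + k * d = s + f + k * e \<and> (\<forall>i<k. c (a + i * d) = q)"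
  proof cases
    case 1
    then show ?thesis using assms by (intro exI[of _ "s + f"] exI[of _ e]) auto
  next
    case 2
    then obtain a d where ad: "0 < d" "a + k * d = f" "\<forall>i<k. c (s + (a + i * d)) = q"
      using assms(1) unfolding focused_def by blast
    have "c ((s + a) + i * (d + e)) = q" if "i < k" for i
    proof -
      have "i * d \<le> k * d" using that by simp
      then have "a + i * d < N" using ad(2) \<open>f < N\<close> by linarith
      from per[OF that this] have "c (s + (a + i * d) + i * e) = q" using ad(3) that by simp
      then show ?thesis by (simp add: algebra_simps)
    qed
    moreover have "s + a + k * (d + e) = s + f + k * e" using ad(2) by (simp add: algebra_simps)
    ultimately show ?thesis using ad(1) by (intro exI[of _ "s + a"] exI[of _ "d + e"]) auto
  qed
qed

lemma focused_extend:
  assumes "focused k c f Q" and "c f \<in> Q"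
  shows "\<exists>a d. 0 < d \<and> a + k * d = f \<and> (\<forall>i<Suc k. c (a + i * d) = c a)"
proof -
  obtain a d where ad: "0 < d" "a + k * d = f" "\<forall>i<k. c (a + i * d) = c f"
    using assms unfolding focused_def by blast
  then have "\<forall>i<Suc k. c (a + i * d) = c f" by (auto simp: less_Suc_eq)
  then show ?thesis using ad(1,2) by (metis mult_0 add_0_right zero_less_Suc)
qed

text \<open>Blocks of length \<open>N\<close> are colored by their restriction of \<open>c\<close>; shifting the \<open>j\<close> focused
  progressions along a progression of equal blocks, together with the shifts of their focus,
  gives \<open>j + 1\<close> of them.\<close>

lemma color_focusing:
  assumes "vdw k"
  shows "\<exists>N. \<forall>c::nat \<Rightarrow> nat. (\<forall>x. c x < r) \<longrightarrow>
     (\<exists>a d. 0 < d \<and> a + k * d < N \<and> (\<forall>i<Suc k. c (a + i * d) = c a)) \<or>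
     (\<exists>f Q. f < N \<and> finite Q \<and> card Q = j \<and> focused k c f Q)"
proof (induction j)
  case 0
  show ?case by (rule exI[of _ 1]) (auto simp: focused_def)
next
  case (Suc j)
  then obtain N where N: "\<And>c::nat \<Rightarrow> nat. (\<forall>x. c x < r) \<Longrightarrow>
     (\<exists>a d. 0 < d \<and> a + k * d < N \<and> (\<forall>i<Suc k. c (a + i * d) = c a)) \<or>
     (\<exists>f Q. f < N \<and> finite Q \<and> card Q = j \<and> focused k c f Q)" by metis
  let ?C = "{xs. set xs \<subseteq> {..<r} \<and> length xs = N}"
  obtain B where B: "\<And>c::nat \<Rightarrow> nat list. (\<forall>x. c x \<in> ?C) \<Longrightarrow>
      \<exists>a d. 0 < d \<and> a + k * d < B \<and> (\<forall>i<k. c (a + i * d) = c a)"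
    using vdw_finite_colors[OF assms finite_lists_length_eq[of "{..<r}" N]] by auto
  show ?case
  proof (intro exI allI impI)
    fix c :: "nat \<Rightarrow> nat" assume c: "\<forall>x. c x < r"
    let ?blk = "\<lambda>b. map (\<lambda>x. c (b * N + x)) [0..<N]"
    obtain b e where be: "0 < e" "b + k * e < B" "\<forall>i<k. ?blk (b + i * e) = ?blk b"
      using B[of ?blk] c by auto
    have per: "c (b * N + x + i * (e * N)) = c (b * N + x)" if "i < k" "x < N" for i x
    proof -
      have "?blk (b + i * e) ! x = ?blk b ! x" using be(3) that by simp
      then show ?thesis using that by (simp add: algebra_simps)
    qed
    \<comment> \<open>The block \<open>b + k * e\<close> holding the new focus need not equal the
      others. It lies among the first \<open>B\<close> blocks because \<open>vdw\<close> also bounds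
      the point after the last term.\<close>
    have bound: "b * N + y + k * (e * N) < B * N" if "y < N" for y
    proof -
      have "b * N + y + k * (e * N) < (b + k * e + 1) * N" using that by (simp add: algebra_simps)
      also have "\<dots> \<le> B * N" using be(2) by (intro mult_right_mono) auto
      finally show ?thesis .
    qed
    let ?c = "\<lambda>x. c (b * N + x)"
    let ?AP = "\<exists>a d. 0 < d \<and> a + k * d < B * N \<and> (\<forall>i<Suc k. c (a + i * d) = c a)"
    have lift: ?AP if ad: "0 < d" "a + k * d < N" "\<forall>i<Suc k. ?c (a + i * d) = ?c a" for a d
      using ad bound[OF ad(2)] by (intro exI[of _ "b * N + a"] exI[of _ d]) (auto simp: algebra_simps)
    from N[of ?c] c consider
        (ap) a d where "0 < d" "a + k * d < N" "\<forall>i<Suc k. ?c (a + i * d) = ?c a"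
      | (foc) f Q where "f < N" "finite Q" "card Q = j" "focused k ?c f Q" by auto
    then show "?AP \<or> (\<exists>f Q. f < B * N \<and> finite Q \<and> card Q = Suc j \<and> focused k c f Q)"
    proof cases
      case ap
      then show ?thesis using lift by blast
    next
      case foc
      show ?thesis
      proof (cases "?c f \<in> Q")
        case True
        from focused_extend[OF foc(4) this] show ?thesis using lift foc(1) by blast
      next
        case False
        have "N > 0" using foc(1) by simp
        with be(1) have "e * N > 0" by simp
        from focused_shift[of k c "b * N" f Q "e * N" N, OF foc(4) this per foc(1)]
        have "focused k c (b * N + f + k * (e * N)) (insert (?c f) Q)" .
        moreover have "card (insert (?c f) Q) = Suc j" using False foc by simp
        ultimately show ?thesis using bound[OF foc(1)] foc(2) by blast
      qed
    qed
  qed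
qed

text \<open>With only \<open>r\<close> colors there cannot be \<open>r + 1\<close> focused ones, so
  color focusing for \<open>j = Suc r\<close> must yield the longer progression.\<close>

lemma vdw_Suc:
  assumes "vdw k" and "k > 0"
  shows "vdw (Suc k)"
  unfolding vdw_def
proof
  fix r
  obtain N where N: "\<And>c::nat \<Rightarrow> nat. (\<forall>x. c x < r) \<Longrightarrow>
     (\<exists>a d. 0 < d \<and> a + k * d < N \<and> (\<forall>i<Suc k. c (a + i * d) = c a)) \<or>
     (\<exists>f Q. f < N \<and> finite Q \<and> card Q = Suc r \<and> focused k c f Q)"
    using color_focusing[OF assms(1), of r "Suc r"] by metis
  show "\<exists>N. \<forall>c::nat \<Rightarrow> nat. (\<forall>x. c x < r) \<longrightarrow>
     (\<exists>a d. 0 < d \<and> a + Suc k * d < N \<and> (\<forall>i<Suc k. c (a + i * d) = c a))"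
  \<comment> \<open>Doubling pays for the extra step that \<open>vdw (Suc k)\<close> demands:
    \<open>d\<close> is at most \<open>k * d\<close>, which is below \<open>N\<close>.\<close>
  proof (rule exI[of _ "2 * N"], intro allI impI)
    fix c :: "nat \<Rightarrow> nat" assume c: "\<forall>x. c x < r"
    have "\<not> (finite Q \<and> card Q = Suc r \<and> focused k c f Q)" for f Q
    proof
      assume *: "finite Q \<and> card Q = Suc r \<and> focused k c f Q"
      have "Q \<subseteq> {..<r}"
      proof
        fix q assume "q \<in> Q"
        then obtain a d where "\<forall>i<k. c (a + i * d) = q" using * unfolding focused_def by blast
        then show "q \<in> {..<r}" using c \<open>k > 0\<close> by auto
      qed
      then have "card Q \<le> r" using card_mono[of "{..<r}" Q] by simp
      with * show False by simp
    qed
    with N[OF c] obtain a d where ad: "0 < d" "a + k * d < N" "\<forall>i<Suc k. c (a + i * d) = c a"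
      by blast
    have "d \<le> k * d" using \<open>k > 0\<close> by simp
    then have "a + Suc k * d < 2 * N" using ad(2) unfolding mult_Suc by linarith
    with ad show "\<exists>a d. 0 < d \<and> a + Suc k * d < 2 * N \<and> (\<forall>i<Suc k. c (a + i * d) = c a)" by blast
  qed
qed

theorem van_der_Waerden: "k > 0 \<Longrightarrow> vdw k"
proof (induction k rule: nat_induct_non_zero)
  case 1
  have "\<exists>a d. 0 < d \<and> a + 1 * d < (2::nat) \<and> (\<forall>i<1. c (a + i * d) = c a)" for c :: "nat \<Rightarrow> nat"
    by (intro exI[of _ 0] exI[of _ 1]) simp
  then show ?case unfolding vdw_def by blast
next
  case (Suc k)
  then show ?case by (rule_tac vdw_Suc)
qed

section \<open>Lower bounds on \<open>W_c\<close> from a single coloring\<close>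

lemma cyclic_AP_of_AP:
  assumes "0 < d" and "a + k * d < M" and "k > 0"
  shows "cyclic_AP k M d ((\<lambda>i. a + i * d) ` {0..<k})"
proof -
  have "a + i * d < M" if "i < k" for i
  proof -
    have "i * d \<le> k * d" using that by simp
    then show ?thesis using assms(2) by linarith
  qed
  then have "(\<lambda>i. a + i * d) ` {0..<k} = (\<lambda>i. (a + i * d) mod M) ` {0..<k}"
    by (intro image_cong) auto
  moreover have "card ((\<lambda>i. a + i * d) ` {0..<k}) = k"
    using \<open>0 < d\<close> by (subst card_image) (auto simp: inj_on_def)
  ultimately show ?thesis unfolding cyclic_AP_def using assms(2) by force
qed

text \<open>A progression of integers below \<open>M\<close> is also cyclic mod \<open>M\<close>, so
  van der Waerden's theorem supplies a witness for \<open>LEAST\<close>. The least number then has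
  the defining property itself, and \<open>W_c k r \<le> L \<le> M\<close> would contradict the
  given coloring.\<close>

lemma less_W_cI:
  assumes "k > 0" and "M \<ge> L" and "coloring r {0..<M} c"
    and nomono: "\<And>d A. 0 < d \<Longrightarrow> cyclic_AP k M d A \<Longrightarrow> \<not> monochromatic c A"
  shows "W_c k r > L"
proof -
  let ?P = "\<lambda>N. N > 0 \<and> (\<forall>M\<ge>N. \<forall>c. coloring r {0..<M} c \<longrightarrow>
        (\<exists>d>0. \<exists>A. cyclic_AP k M d A \<and> monochromatic c A))"
  obtain N where N: "\<And>c::nat \<Rightarrow> nat. (\<forall>x. c x < Suc r) \<Longrightarrow>
      \<exists>a d. 0 < d \<and> a + k * d < N \<and> (\<forall>i<k. c (a + i * d) = c a)"
    using van_der_Waerden[OF \<open>k > 0\<close>] unfolding vdw_def by metis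
  have "?P (Suc N)"
  proof (intro conjI allI impI)
    fix M and c :: "nat \<Rightarrow> nat" assume M: "Suc N \<le> M" and c: "coloring r {0..<M} c"
    \<comment> \<open>The default 0 makes the coloring total with values in 0..r, hence
      \<open>Suc r\<close> colors. The progression found stays below \<open>M\<close>, where
      \<open>?c\<close> and \<open>c\<close> agree.\<close>
    let ?c = "\<lambda>x. if x < M then c x else 0"
    have "\<forall>x. ?c x < Suc r" using c unfolding coloring_def by (auto simp: Pi_iff less_Suc_eq_le)
    from N[OF this] obtain a d where ad: "0 < d" "a + k * d < N" "\<forall>i<k. ?c (a + i * d) = ?c a"
      by blast
    have "a + i * d < M" if "i < k" for i
    proof -
      have "i * d \<le> k * d" using that by simp
      then show ?thesis using ad(2) M by linarith
    qed
    moreover from this[of 0] \<open>k > 0\<close> have "a < M" by simp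
    ultimately have "c (a + i * d) = c a" if "i < k" for i using ad(3) that by simp
    then have "monochromatic c ((\<lambda>i. a + i * d) ` {0..<k})" unfolding monochromatic_def by auto
    moreover have "cyclic_AP k M d ((\<lambda>i. a + i * d) ` {0..<k})"
      using ad M \<open>k > 0\<close> by (intro cyclic_AP_of_AP) auto
    ultimately show "\<exists>d>0. \<exists>A. cyclic_AP k M d A \<and> monochromatic c A" using ad(1) by blast
  qed simp
  then have "?P (W_c k r)" unfolding W_c_def by (rule LeastI)
  with assms show ?thesis by (meson not_less order.trans)
qed

section \<open>Three colors on an initial segment\<close>

text \<open>Reversing a progression replaces the difference \<open>d\<close> by \<open>M - d\<close>, and \<open>2 * d = M\<close> would
  make the first and the third term coincide.\<close>

lemma cyclic_AP_small_difference:
  assumes "cyclic_AP k M d A" and "k \<ge> 3"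
  obtains a e where "a < M" "2 * e < M" "inj_on (\<lambda>i. (a + i * e) mod M) {0..<k}"
    "A = (\<lambda>i. (a + i * e) mod M) ` {0..<k}"
proof -
  from assms(1) obtain t where t: "t < M" and card: "card A = k"
    and A: "A = (\<lambda>i. (t + i * d) mod M) ` {0..<k}" unfolding cyclic_AP_def by auto
  define e where "e = d mod M"
  have eM: "e < M" using t by (simp add: e_def)
  have "(t + i * d) mod M = (t + i * e) mod M" for i
    unfolding e_def by (metis mod_add_right_eq mod_mult_right_eq)
  with A have A: "A = (\<lambda>i. (t + i * e) mod M) ` {0..<k}" by simp
  have inj: "inj_on (\<lambda>i. (b + i * e') mod M) {0..<k}"
    if "A = (\<lambda>i. (b + i * e') mod M) ` {0..<k}" for b e'
    by (rule eq_card_imp_inj_on) (use card that in auto)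
  have "2 * e \<noteq> M"
  proof
    assume "2 * e = M"
    then have "(t + 0 * e) mod M = (t + 2 * e) mod M" by simp
    from inj_onD[OF inj[OF A] this] show False using \<open>k \<ge> 3\<close> by auto
  qed
  then consider "2 * e < M" | "2 * (M - e) < M" using eM by linarith
  then show ?thesis
  proof cases
    case 1
    then show ?thesis using that[OF t _ inj[OF A] A] by blast
  next
    case 2
    let ?b = "(t + (k - 1) * e) mod M"
    have rev: "(?b + i * (M - e)) mod M = (t + (k - 1 - i) * e) mod M" if "i < k" for i
    proof -
      have "(k - 1) * e = (k - 1 - i) * e + i * e"
        using that by (simp flip: add_mult_distrib)
      then have "t + (k - 1) * e + i * (M - e) = t + (k - 1 - i) * e + i * M"
        using eM by (simp add: diff_mult_distrib2)
      then show ?thesis by (metis mod_add_left_eq mod_mult_self1)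
    qed
    have "(\<lambda>i. (t + i * e) mod M) ` {0..<k} = (\<lambda>i. (t + (k - 1 - i) * e) mod M) ` {0..<k}"
      unfolding image_image[of "\<lambda>i. (t + i * e) mod M" "\<lambda>i. k - 1 - i", symmetric]
    proof (rule arg_cong[where f = "image _"])
      show "{0..<k} = (\<lambda>i. k - 1 - i) ` {0..<k}"
      proof (intro equalityI subsetI)
        fix i assume "i \<in> {0..<k}"
        then show "i \<in> (\<lambda>i. k - 1 - i) ` {0..<k}" by (intro image_eqI[of _ _ "k - 1 - i"]) auto
      qed auto
    qed
    also have "\<dots> = (\<lambda>i. (?b + i * (M - e)) mod M) ` {0..<k}"
      using rev by (intro image_cong) auto
    finally have A': "A = (\<lambda>i. (?b + i * (M - e)) mod M) ` {0..<k}" using A by simp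
    show ?thesis by (rule that[OF _ 2 inj[OF A'] A']) (use t in simp)
  qed
qed

section \<open>Counting argument for \<open>k \<ge> 8\<close>\<close>

text \<open>The first-moment method as a count: each member of \<open>F\<close> is monochromatic in
  at most \<open>r * r ^ (card S - k)\<close> of the \<open>r ^ card S\<close> colorings, so fewer
  than \<open>r ^ (k - 1)\<close> members cannot spoil all of them.\<close>

lemma union_bound_coloring:
  fixes F :: "'a set set"
  assumes "finite S" "F \<subseteq> Pow S" "\<And>A. A \<in> F \<Longrightarrow> card A = k" "k > 0" "r > 0"
    and less: "card F < r ^ (k - 1)"
  shows "\<exists>f\<in>S \<rightarrow> {..<r}. \<forall>A\<in>F. \<not> monochromatic f A"
proof (rule ccontr)
  assume neg: "\<not> ?thesis"
  let ?C = "S \<rightarrow>\<^sub>E {..<r}"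
  define X where "X A = {f \<in> ?C. monochromatic f A}" for A
  have fin: "finite ?C" using \<open>finite S\<close> by (intro finite_PiE) auto
  have cardC: "card ?C = r ^ card S" using \<open>finite S\<close> by (simp add: card_PiE)
  have "finite F" using assms(1,2) finite_subset by blast
  have cover: "?C \<subseteq> (\<Union>A\<in>F. X A)"
  proof
    fix f assume f: "f \<in> ?C"
    then have "f \<in> S \<rightarrow> {..<r}" by (auto simp: PiE_def)
    with neg f show "f \<in> (\<Union>A\<in>F. X A)" by (auto simp: X_def)
  qed
  have bound: "card (X A) \<le> r * r ^ (card S - k)" and "k \<le> card S" if "A \<in> F" for A
  proof -
    have "A \<subseteq> S" "card A = k" using assms that by auto
    then have "finite A" "A \<noteq> {}" using \<open>finite S\<close> finite_subset \<open>k > 0\<close> by auto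
    then obtain a where "a \<in> A" by blast
    show "k \<le> card S" using \<open>A \<subseteq> S\<close> \<open>card A = k\<close> \<open>finite S\<close> card_mono by blast
    \<comment> \<open>A coloring constant on \<open>A\<close> is determined by its value at one
      point of \<open>A\<close> and its restriction to the rest of \<open>S\<close>.\<close>
    let ?h = "\<lambda>f. (f a, restrict f (S - A))"
    have "inj_on ?h (X A)"
    proof (rule inj_onI)
      fix f g assume f: "f \<in> X A" and g: "g \<in> X A" and h: "?h f = ?h g"
      show "f = g"
      proof
        fix x
        consider "x \<in> A" | "x \<in> S - A" | "x \<notin> S" by blast
        then show "f x = g x"
        proof cases
          case 1
          then have "f x = f a" "g x = g a" using f g \<open>a \<in> A\<close>
            unfolding X_def monochromatic_def by auto
          with h show ?thesis by simp
        next
          case 2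
          then show ?thesis using h by (auto dest!: fun_cong[of _ _ x])
        next
          case 3
          then show ?thesis using f g unfolding X_def by (auto simp: PiE_def extensional_def)
        qed
      qed
    qed
    moreover have "?h ` X A \<subseteq> {..<r} \<times> ((S - A) \<rightarrow>\<^sub>E {..<r})"
      using \<open>a \<in> A\<close> \<open>A \<subseteq> S\<close> unfolding X_def by (auto simp: PiE_def Pi_iff)
    moreover have "finite ({..<r} \<times> ((S - A) \<rightarrow>\<^sub>E {..<r}))"
      using \<open>finite S\<close> by (intro finite_cartesian_product finite_PiE) auto
    ultimately have "card (X A) \<le> card ({..<r} \<times> ((S - A) \<rightarrow>\<^sub>E {..<r}))"
      by (intro card_inj_on_le[of ?h])
    also have "\<dots> = r * r ^ (card S - k)"
      using \<open>finite S\<close> \<open>A \<subseteq> S\<close> \<open>card A = k\<close> \<open>finite A\<close>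
      by (simp add: card_cartesian_product card_PiE card_Diff_subset)
    finally show "card (X A) \<le> r * r ^ (card S - k)" .
  qed
  \<comment> \<open>A member of \<open>F\<close> is needed to get \<open>k \<le> card S\<close>, so
    that the truncated exponent \<open>card S - k\<close> is the true difference.\<close>
  have "F \<noteq> {}" using cover fin cardC \<open>r > 0\<close> by auto
  then have kS: "k \<le> card S" using \<open>\<And>A. A \<in> F \<Longrightarrow> k \<le> card S\<close> by auto
  have "r ^ card S \<le> card (\<Union>A\<in>F. X A)"
    unfolding cardC[symmetric] using fin \<open>finite F\<close> cover
    by (intro card_mono finite_UN_I) (auto simp: X_def)
  also have "\<dots> \<le> (\<Sum>A\<in>F. card (X A))" using \<open>finite F\<close> by (rule card_UN_le)
  also have "\<dots> \<le> card F * (r * r ^ (card S - k))"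
    using sum_bounded_above[of F "\<lambda>A. card (X A)"] bound by simp
  also have "\<dots> < r ^ (k - 1) * (r * r ^ (card S - k))"
    using less \<open>r > 0\<close> by simp
  also have "\<dots> = r ^ card S"
    using kS \<open>k > 0\<close> by (simp flip: power_add power_Suc)
  finally show False by simp
qed

text \<open>Used to see that the differences from \<open>x\<close> to \<open>y\<close> and from
  \<open>y\<close> to \<open>x\<close> cannot both be below \<open>M / 2\<close>.\<close>

lemma mod_diff_sum:
  fixes x y M :: nat
  assumes "x < M" "y < M" "x \<noteq> y"
  shows "(y + M - x) mod M + (x + M - y) mod M = M"
proof -
  have *: "(v + M - u) mod M + (u + M - v) mod M = M" if "u < v" "v < M" for u v
  proof -
    have "v + M - u = (v - u) + M" "v - u < M" using that by simp_all
    then have "(v + M - u) mod M = v - u" by (metis mod_add_self2 mod_less)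
    then show ?thesis using that by simp
  qed
  show ?thesis using *[of x y] *[of y x] assms by (cases "x < y") auto
qed

text \<open>A progression with difference below \<open>M / 2\<close> is determined by its first two
  terms. Of an ordered pair and its swap at most one has such a difference, so at most half of the
  \<open>n ^ 2\<close> pairs occur.\<close>

lemma card_cyclic_APs_below:
  assumes "k \<ge> 3" "n \<le> M"
  shows "2 * card {A. A \<subseteq> {..<n} \<and> (\<exists>d. cyclic_AP k M d A)} \<le> n ^ 2"
proof -
  let ?F = "{A. A \<subseteq> {..<n} \<and> (\<exists>d. cyclic_AP k M d A)}"
  define P where "P = {(x, y). x < n \<and> y < n \<and> x \<noteq> y \<and> 2 * ((y + M - x) mod M) < M}"
  let ?G = "\<lambda>(x, y). (\<lambda>i. (x + i * ((y + M - x) mod M)) mod M) ` {0..<k}"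
  have P: "P \<subseteq> {..<n} \<times> {..<n}" unfolding P_def by auto
  then have finP: "finite P" by (rule finite_subset) simp
  have "?F \<subseteq> ?G ` P"
  proof
    fix A assume "A \<in> ?F"
    then obtain d where A: "A \<subseteq> {..<n}" and "cyclic_AP k M d A" by blast
    from cyclic_AP_small_difference[OF this(2) \<open>k \<ge> 3\<close>] obtain a e
      where ae: "a < M" "2 * e < M" and inj: "inj_on (\<lambda>i. (a + i * e) mod M) {0..<k}"
        and A': "A = (\<lambda>i. (a + i * e) mod M) ` {0..<k}" .
    define b where "b = (a + e) mod M"
    have mem: "(a + i * e) mod M < n" if "i < k" for i
    proof -
      have "(a + i * e) mod M \<in> A" using that A' by simp
      then show ?thesis using A by blast
    qed
    from mem[of 0] mem[of 1] have an: "a < n" and bn: "b < n"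
      using \<open>k \<ge> 3\<close> ae by (auto simp: b_def)
    have "a \<noteq> b" using inj_onD[OF inj, of 0 1] ae \<open>k \<ge> 3\<close> by (auto simp: b_def)
    have "(b + M - a) mod M = e"
    proof (cases "a + e < M")
      case True
      then have "b + M - a = e + M" by (simp add: b_def)
      then show ?thesis using ae by simp
    next
      case False
      then have "b = a + e - M" using ae by (simp add: b_def mod_if)
      then have "b + M - a = e" using False by simp
      then show ?thesis using ae by simp
    qed
    then have "(a, b) \<in> P" "A = ?G (a, b)" using an bn \<open>a \<noteq> b\<close> ae A' by (auto simp: P_def)
    then show "A \<in> ?G ` P" by blast
  qed
  then have "card ?F \<le> card P" using finP by (rule surj_card_le[rotated])
  moreover have "P \<inter> prod.swap ` P = {}"
  proof -
    have "\<not> 2 * ((x + M - y) mod M) < M" if "(x, y) \<in> P" for x y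
      using mod_diff_sum[of x M y] that \<open>n \<le> M\<close> by (auto simp: P_def)
    then show ?thesis by (auto simp: P_def)
  qed
  then have "card P + card (prod.swap ` P) = card (P \<union> prod.swap ` P)"
    using finP by (subst card_Un_disjoint) auto
  moreover have "card (P \<union> prod.swap ` P) \<le> card ({..<n} \<times> {..<n})"
    using P by (intro card_mono) auto
  moreover have "card (prod.swap ` P) = card P" by (intro card_image) simp
  ultimately show ?thesis by (simp add: card_cartesian_product power2_eq_square)
qed

definition three_colorable :: "nat \<Rightarrow> nat \<Rightarrow> bool" where
  "three_colorable k M \<longleftrightarrow> (\<exists>f \<in> {..<k ^ 2} \<rightarrow> {..<3}. \<forall>d A.
     cyclic_AP k M d A \<longrightarrow> A \<subseteq> {..<k ^ 2} \<longrightarrow> \<not> monochromatic f A)"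

text \<open>This fixes the threshold 8: there 4096 < 4374, while at 7 the inequality fails with 2401
  against 1458. In the induction the left side grows by a factor of at most 3.\<close>

lemma power4_less_power3: "k \<ge> 8 \<Longrightarrow> k ^ 4 < 2 * 3 ^ (k - 1)" for k :: nat
proof (induction k rule: dec_induct)
  case base
  show ?case by simp
next
  case (step n)
  have e: "3 ^ (Suc n - 1) = 3 * (3::nat) ^ (n - 1)" using step by (cases n) auto
  have "8 * n ^ 3 \<le> n ^ 4" using step(1) by (simp add: power4_eq_xxxx power3_eq_cube)
  moreover have "n ^ 2 * 8 \<le> n ^ 3" using step(1) by (simp add: power2_eq_square power3_eq_cube)
  moreover have "n * 8 \<le> n ^ 2" using step(1) by (simp add: power2_eq_square)
  moreover have "Suc n ^ 4 = n ^ 4 + 4 * n ^ 3 + 6 * n ^ 2 + 4 * n + 1"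
    by (simp add: power4_eq_xxxx power3_eq_cube power2_eq_square algebra_simps)
  ultimately have "Suc n ^ 4 \<le> 3 * n ^ 4" using step(1) by linarith
  with step(3) show ?case unfolding e by linarith
qed

lemma three_colorable_large:
  assumes "k \<ge> 8" "k ^ 2 \<le> M"
  shows "three_colorable k M"
proof -
  let ?F = "{A. A \<subseteq> {..<k ^ 2} \<and> (\<exists>d. cyclic_AP k M d A)}"
  have "2 * card ?F \<le> (k ^ 2) ^ 2" using assms by (intro card_cyclic_APs_below) auto
  also have "\<dots> = k ^ 4" by simp
  also have "\<dots> < 2 * 3 ^ (k - 1)" using assms(1) by (rule power4_less_power3)
  finally have "card ?F < 3 ^ (k - 1)" by simp
  then have "\<exists>f\<in>{..<k ^ 2} \<rightarrow> {..<3}. \<forall>A\<in>?F. \<not> monochromatic f A"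
    using assms(1) by (intro union_bound_coloring) (auto simp: cyclic_AP_def)
  then show ?thesis unfolding three_colorable_def by blast
qed

section \<open>Explicit colorings for \<open>k \<le> 7\<close>\<close>

text \<open>Integer lists keep the numerals binary under code_simp.\<close>

definition AP_free_mod :: "nat \<Rightarrow> int \<Rightarrow> int list \<Rightarrow> bool" where
  "AP_free_mod k M L \<longleftrightarrow> (\<forall>x\<in>set L. \<forall>y\<in>set L. let d = (y - x) mod M in
     M \<le> 2 * d \<or> (\<exists>i\<in>set [0..<k]. (x + int i * d) mod M \<notin> set L) \<or>
     (\<exists>i\<in>set [1..<k]. int i * d mod M = 0))"

text \<open>The check runs over candidates \<open>x\<close>, \<open>y\<close> for the first two
  terms. Its three escapes (large difference, a term outside \<open>L\<close>, a return to the first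
  term) contradict \<open>2 * e < M\<close>, \<open>mem\<close> and \<open>inj\<close>
  respectively.\<close>

lemma AP_free_modD:
  assumes "AP_free_mod k (int M) L" and "a < M" "2 * e < M" "k \<ge> 3"
    and inj: "inj_on (\<lambda>i. (a + i * e) mod M) {0..<k}"
    and mem: "\<And>i. i < k \<Longrightarrow> int ((a + i * e) mod M) \<in> set L"
  shows False
proof -
  define d where "d = (int ((a + e) mod M) - int a) mod int M"
  have "d = int e" unfolding d_def using \<open>2 * e < M\<close>
    by (simp add: zmod_int mod_diff_left_eq)
  have "int a \<in> set L" "int ((a + e) mod M) \<in> set L"
    using mem[of 0] mem[of 1] assms(2,4) by auto
  then have "int M \<le> 2 * d \<or> (\<exists>i\<in>set [0..<k]. (int a + int i * d) mod int M \<notin> set L) \<or>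
     (\<exists>i\<in>set [1..<k]. int i * d mod int M = 0)"
    using assms(1) unfolding AP_free_mod_def d_def Let_def by blast
  then consider "int M \<le> 2 * int e" | i where "i < k" "(int a + int i * int e) mod int M \<notin> set L"
    | i where "1 \<le> i" "i < k" "int i * int e mod int M = 0"
    unfolding \<open>d = int e\<close> by auto
  then show False
  proof cases
    case 1
    then show ?thesis using \<open>2 * e < M\<close> by simp
  next
    case (2 i)
    then show ?thesis using mem[of i] by (simp add: zmod_int)
  next
    case (3 i)
    then have "i * e mod M = 0" by (metis of_nat_0_eq_iff of_nat_mult zmod_int)
    then have "(a + i * e) mod M = (a + 0 * e) mod M"
      by (metis add_0_right mod_add_right_eq mult_0)
    from inj_onD[OF inj this] show ?thesis using 3 by auto
  qed
qed

text \<open>From a term below \<open>M / 2\<close>, a step below \<open>M / 2\<close> cannot reach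
  \<open>M\<close>, so the next sum is already reduced.\<close>

lemma small_step_no_wrap:
  fixes a e n M :: nat
  assumes "2 * n \<le> M" "2 * e < M" "a < M" and "\<And>i. i < k \<Longrightarrow> (a + i * e) mod M < n"
  shows "i < k \<Longrightarrow> a + i * e < n"
proof (induction i)
  case 0
  then show ?case using assms(3) assms(4)[of 0] by simp
next
  case (Suc i)
  then have "a + Suc i * e < M" using assms(1,2) by simp
  then show ?case using assms(4)[OF Suc.prems] by simp
qed

text \<open>Once \<open>M \<ge> 2 * k ^ 2\<close>, no progression inside the first \<open>k ^ 2\<close> residues wraps around, so
  the modulus \<open>2 * k ^ 2\<close> stands for all larger ones.\<close>

definition valid_color_classes :: "nat \<Rightarrow> int list list \<Rightarrow> bool" where
  "valid_color_classes k Ls \<longleftrightarrow> length Ls = 3 \<and>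
     (\<forall>x\<in>set [0..int k ^ 2 - 1]. \<exists>L\<in>set Ls. x \<in> set L) \<and>
     (\<forall>j\<in>set [k + 1..<2 * k + 1]. \<forall>L\<in>set Ls. AP_free_mod k (int j * int k) L)"

lemma three_colorable_valid_color_classes:
  assumes "k \<ge> 3" "k < m" and valid: "valid_color_classes k Ls"
  shows "three_colorable k (m * k)"
proof -
  have "\<exists>j<3. int x \<in> set (Ls ! j)" if "x < k ^ 2" for x
  proof -
    have "int x < int k ^ 2" using that by (metis of_nat_less_iff of_nat_power)
    then have "\<exists>L\<in>set Ls. int x \<in> set L" using valid unfolding valid_color_classes_def by auto
    then show ?thesis using valid unfolding valid_color_classes_def by (metis in_set_conv_nth)
  qed
  \<comment> \<open>\<open>f x\<close> is the index of a list containing \<open>x\<close>. Each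
    color class of \<open>f\<close> thus lies inside one list and inherits its freeness from
    progressions.\<close>
  then obtain f where f: "\<And>x. x < k ^ 2 \<Longrightarrow> f x < 3 \<and> int x \<in> set (Ls ! f x)" by metis
  have "\<not> monochromatic f A" if AP: "cyclic_AP k (m * k) d A" and A: "A \<subseteq> {..<k ^ 2}" for d A
  proof
    assume "monochromatic f A"
    then obtain j where j: "\<And>x. x \<in> A \<Longrightarrow> f x = j" unfolding monochromatic_def by blast
    from cyclic_AP_small_difference[OF AP \<open>k \<ge> 3\<close>] obtain a e
      where ae: "a < m * k" "2 * e < m * k"
        and inj: "inj_on (\<lambda>i. (a + i * e) mod (m * k)) {0..<k}"
        and A': "A = (\<lambda>i. (a + i * e) mod (m * k)) ` {0..<k}" .
    have mem: "(a + i * e) mod (m * k) \<in> A" if "i < k" for i using that A' by auto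
    with A have less: "(a + i * e) mod (m * k) < k ^ 2" if "i < k" for i using that by blast
    \<comment> \<open>\<open>m' * k\<close> is one of the moduli covered by the check, and the
      progression has the same residues mod \<open>m' * k\<close> as mod
      \<open>m * k\<close>.\<close>
    define m' where "m' = min m (2 * k)"
    have "a < m' * k \<and> 2 * e < m' * k \<and>
        (\<forall>i<k. (a + i * e) mod (m' * k) = (a + i * e) mod (m * k))"
    proof (cases "m \<le> 2 * k")
      case True
      then show ?thesis using ae by (simp add: m'_def)
    next
      case False
      then have m': "m' * k = 2 * k ^ 2" by (simp add: m'_def power2_eq_square)
      have M: "2 * k ^ 2 \<le> m * k" using False by (simp add: power2_eq_square)
      note nowrap = small_step_no_wrap[OF M ae(2,1) less]
      have "a < k ^ 2" "a + e < k ^ 2" using nowrap[of k 0] nowrap[of k 1] \<open>k \<ge> 3\<close> by auto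
      moreover have "(a + i * e) mod (2 * k ^ 2) = (a + i * e) mod (m * k)" if "i < k" for i
        using nowrap[OF _ that] M by simp
      ultimately show ?thesis unfolding m' by simp
    qed
    note * = this[THEN conjunct1] this[THEN conjunct2, THEN conjunct1]
      this[THEN conjunct2, THEN conjunct2, rule_format]
    have "j < 3" using f[OF less[of 0]] j[OF mem[of 0]] \<open>k \<ge> 3\<close> by auto
    have "m' \<in> set [k + 1..<2 * k + 1]" using assms(1,2) by (auto simp: m'_def)
    moreover have "Ls ! j \<in> set Ls"
      using \<open>j < 3\<close> valid unfolding valid_color_classes_def by simp
    ultimately have "AP_free_mod k (int (m' * k)) (Ls ! j)"
      using valid unfolding valid_color_classes_def of_nat_mult by blast
    moreover have "inj_on (\<lambda>i. (a + i * e) mod (m' * k)) {0..<k}"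
      using inj *(3) by (subst inj_on_cong[of _ _ "\<lambda>i. (a + i * e) mod (m * k)"]) auto
    moreover have "int ((a + i * e) mod (m' * k)) \<in> set (Ls ! j)" if "i < k" for i
      using f[OF less[OF that]] j[OF mem[OF that]] *(3)[OF that] by simp
    ultimately show False using AP_free_modD[OF _ *(1,2) \<open>k \<ge> 3\<close>] by blast
  qed
  then show ?thesis unfolding three_colorable_def using f by (intro bexI[of _ f]) auto
qed

text \<open>The color classes below come from a computer search.\<close>

lemma valid_color_classes_3:
  "valid_color_classes 3 [[2, 3, 8], [0, 4, 6, 7], [1, 5]]"
  by code_simp

lemma valid_color_classes_4:
  "valid_color_classes 4 [[1, 11, 14, 15], [4, 5, 6, 8, 12], [0, 2, 3, 7, 9, 10, 13]]"
  by code_simp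

lemma valid_color_classes_5:
  "valid_color_classes 5 [[6, 7, 8, 10, 14], [0, 3, 4, 12, 13, 17, 18, 19, 20, 22], [1, 2, 5, 9, 11, 15, 16, 21, 23, 24]]"
  by code_simp

lemma valid_color_classes_6:
  "valid_color_classes 6 [[0, 1, 4, 5, 7, 9, 13, 14, 15, 16, 18, 19, 20, 28, 29, 34, 35], [2, 3, 6, 10, 11, 12, 22, 23, 25, 31], [8, 17, 21, 24, 26, 27, 30, 32, 33]]"
  by code_simp

lemma valid_color_classes_7:
  "valid_color_classes 7 [[0, 1, 11, 13, 14, 15, 16, 21, 23, 26, 28, 29, 31, 48], [3, 5, 6, 7, 10, 12, 17, 18, 19, 20, 25, 30, 32, 37, 38, 39, 40, 41, 45, 46], [2, 4, 8, 9, 22, 24, 27, 33, 34, 35, 36, 42, 43, 44, 47]]"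
  by code_simp

section \<open>Combining the two ranges of \<open>k\<close> and coloring the remaining
  blocks\<close>

lemma three_colorable:
  assumes "k \<ge> 3" "k < m"
  shows "three_colorable k (m * k)"
proof (cases "k \<ge> 8")
  case True
  have "k ^ 2 \<le> m * k" using assms(2) by (simp add: power2_eq_square)
  then show ?thesis by (rule three_colorable_large[OF True])
next
  case False
  with assms(1) consider "k = 3" | "k = 4" | "k = 5" | "k = 6" | "k = 7" by linarith
  then have "\<exists>Ls. valid_color_classes k Ls"
    by cases (use valid_color_classes_3 valid_color_classes_4 valid_color_classes_5
        valid_color_classes_6 valid_color_classes_7 in blast)+
  then show ?thesis using three_colorable_valid_color_classes assms by blast
qed

theorem proposition4p8:
  fixes k m :: nat
  assumes "k \<ge> 3" and "k < m"
  shows "W_c k (3 + nat \<lceil>(real m - real k) * real k / (real k - 1)\<rceil>) > m * k"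
proof -
  let ?s = "nat \<lceil>(real m - real k) * real k / (real k - 1)\<rceil>"
  obtain f where f: "\<And>x. x < k ^ 2 \<Longrightarrow> f x < 3"
    and nomono: "\<And>d A. cyclic_AP k (m * k) d A \<Longrightarrow> A \<subseteq> {..<k ^ 2} \<Longrightarrow> \<not> monochromatic f A"
    using three_colorable[OF assms] unfolding three_colorable_def by (auto simp: Pi_iff)
  \<comment> \<open>Colors 1 to 3 belong to \<open>f\<close>; the blocks of length
    \<open>k - 1\<close> beyond \<open>k ^ 2\<close> are numbered from 4.\<close>
  define c where "c x = (if x < k ^ 2 then f x + 1 else 4 + (x - k ^ 2) div (k - 1))" for x
  \<comment> \<open>A block index is an integer strictly below the real quotient, hence below its
    ceiling \<open>?s\<close>. So the largest color, 4 plus an index, is at most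
    \<open>3 + ?s\<close>.\<close>
  have block: "(x - k ^ 2) div (k - 1) < ?s" if "x < m * k" "\<not> x < k ^ 2" for x
  proof -
    have "real ((x - k ^ 2) div (k - 1)) \<le> real (x - k ^ 2) / real (k - 1)"
      by (rule of_nat_div_le_of_nat)
    also have "\<dots> = real (x - k ^ 2) / (real k - 1)" using assms(1) by (simp add: of_nat_diff)
    also have "\<dots> < (real m - real k) * real k / (real k - 1)"
    proof (rule divide_strict_right_mono)
      have "real x < real m * real k" using that(1) by (metis of_nat_less_iff of_nat_mult)
      then show "real (x - k ^ 2) < (real m - real k) * real k"
        using that(2) by (simp add: of_nat_diff algebra_simps power2_eq_square)
    qed (use assms(1) in simp)
    finally show ?thesis by linarith
  qed
  show ?thesis
  proof (rule less_W_cI)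
    show "coloring (3 + ?s) {0..<m * k} c"
      unfolding coloring_def c_def using f block by (fastforce simp: Pi_iff)
    fix d A assume AP: "cyclic_AP k (m * k) d A"
    then have A: "card A = k" unfolding cyclic_AP_def by simp
    show "\<not> monochromatic c A"
    proof
      assume "monochromatic c A"
      then obtain j where j: "\<And>x. x \<in> A \<Longrightarrow> c x = j" unfolding monochromatic_def by blast
      show False
      proof (cases "j \<le> 3")
        case True
        have low: "x < k ^ 2" if "x \<in> A" for x
          using j[OF that] True by (auto simp: c_def split: if_splits)
        then have "f x = j - 1" if "x \<in> A" for x using j[OF that] that by (auto simp: c_def)
        then have "monochromatic f A" unfolding monochromatic_def by blast
        with nomono[OF AP] low show False by auto
      next
        case False
        have shift: "p + q \<le> p + y \<and> p + y < p + q + w" if "q \<le> y" "y < w + q"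
          for p q y w :: nat using that by simp
        \<comment> \<open>Here \<open>j \<ge> 4\<close>, so \<open>A\<close> lies in the single
          block numbered \<open>j - 4\<close>, which has only \<open>k - 1\<close> elements.\<close>
        have "A \<subseteq> {k ^ 2 + (j - 4) * (k - 1)..<k ^ 2 + (j - 4) * (k - 1) + (k - 1)}"
        proof
          fix x assume "x \<in> A"
          have high: "\<not> x < k ^ 2" using j[OF \<open>x \<in> A\<close>] f[of x] False by (auto simp: c_def)
          then obtain y where x: "x = k ^ 2 + y" by (metis le_Suc_ex not_less)
          with j[OF \<open>x \<in> A\<close>] have "y div (k - 1) = j - 4" by (auto simp: c_def)
          then have "(j - 4) * (k - 1) \<le> y" "y < (k - 1) + (j - 4) * (k - 1)"
            using div_times_less_eq_dividend[of y "k - 1"] dividend_less_div_times[of "k - 1" y]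
              assms(1) by simp_all
          then show "x \<in> {k ^ 2 + (j - 4) * (k - 1)..<k ^ 2 + (j - 4) * (k - 1) + (k - 1)}"
            unfolding x atLeastLessThan_iff by (intro shift)
        qed
        from card_mono[OF finite_atLeastLessThan this] have "card A \<le> k - 1"
          unfolding card_atLeastLessThan by (simp only: add_diff_cancel_left')
        with A assms(1) show False by linarith
      qed
    qed
  qed (use assms in auto)
qed

end
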